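(* For every $p \in [0,1]$ there exist a constant $C_p > 0$ and an integer $N_p$ such that for all integers $n \ge N_p$, if $X \sim \mathrm{Bin}(3n, 1/2)$ and $Y \sim \mathrm{Bin}(2n, p)$, then $$\mathcal{W}_{\infty}\left(\frac{2X}{3}, Y\right) \ge C_p\, n.$$
   Context: $\mathrm{Bin}(m,p)$ is the binomial distribution with $m$ trials and success probability $p$. For two probability measures $\mu, \nu$ on $\mathbb{R}$, the $\infty$-Wasserstein distance is $$\mathcal{W}_{\infty}(\mu,\nu) := \inf_{\gamma \in \pi(\mu,\nu)} \ \gamma\text{-}\operatorname{ess\,sup}_{(x,y)} |x-y|,$$ where $\pi(\mu,\nu)$ is the set of couplings of $\mu$ and $\nu$, i.e. probability measures on $\mathbb{R}\times\mathbb{R}$ with first marginal $\mu$ and second marginal $\nu$. For random variables $U \sim \mu$ and $V \sim \nu$ one writes $\mathcal{W}_\infty(U,V) := \mathcal{W}_\infty(\mu,\nu)$; this depends only on the laws of $U$ and $V$. *)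

theory Defs
  imports "HOL-Probability.Probability"
begin

definition couplings :: "real measure \<Rightarrow> real measure \<Rightarrow> (real \<times> real) measure set" where
  "couplings \<mu> \<nu> =
     {\<gamma>. prob_space \<gamma> \<and> sets \<gamma> = sets (borel \<Otimes>\<^sub>M borel) \<and>
         distr \<gamma> borel fst = \<mu> \<and> distr \<gamma> borel snd = \<nu>}"

text \<open>Meant for Borel probability measures. The value is extended real, since the essential
  supremum may be infinite for every coupling.\<close>

definition W_infinity :: "real measure \<Rightarrow> real measure \<Rightarrow> ereal" where
  "W_infinity \<mu> \<nu> = (INF \<gamma> \<in> couplings \<mu> \<nu>. esssup \<gamma> (\<lambda>(x, y). ereal \<bar>x - y\<bar>))"

end

theory Submission
  imports Defs
begin

text \<open>The mass that the law of \<open>Y\<close> puts on an endpoint of its range, \<open>(1 - p)\<^sup>2\<^sup>n\<close> at \<open>0\<close> or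
  \<open>p\<^sup>2\<^sup>n\<close> at \<open>2n\<close>, is at least \<open>4\<^sup>-\<^sup>n\<close> for one of the two. A coupling with \<open>\<bar>2X/3 - Y\<bar> < n/18\<close>
  almost surely would move this mass into the event that \<open>X\<close> is within \<open>n/12\<close> of the
  corresponding endpoint of \<open>{0..3n}\<close>, whose probability is close to \<open>8\<^sup>-\<^sup>n\<close> on the exponential
  scale and, by a Chernoff bound, smaller than \<open>4\<^sup>-\<^sup>n\<close>.\<close>

text \<open>For \<open>s = 1\<close> this is the Chernoff bound for the lower tail (\<open>r < 1\<close>), for \<open>r = 1\<close> and \<open>s < 1\<close>
  the one for the upper tail.\<close>

lemma measure_binomial_pmf_le:
  fixes p r s c :: real
  assumes p: "0 \<le> p" "p \<le> 1" and nonneg: "0 \<le> r" "0 \<le> s" "0 \<le> c"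
    and S: "\<And>k. k \<in> S \<Longrightarrow> k \<le> m \<Longrightarrow> 1 \<le> c * (r ^ k * s ^ (m - k))"
  shows "measure (binomial_pmf m p) S \<le> c * (p * r + (1 - p) * s) ^ m"
proof -
  let ?b = "\<lambda>k. pmf (binomial_pmf m p) k"
  have "set_pmf (binomial_pmf m p) \<subseteq> {..m}"
    using p by (auto simp: set_pmf_binomial_eq split: if_splits)
  then have "S \<inter> set_pmf (binomial_pmf m p) \<subseteq> S \<inter> {..m}"
    by blast
  then have "measure (binomial_pmf m p) S \<le> measure (binomial_pmf m p) (S \<inter> {..m})"
    by (subst measure_Int_set_pmf[symmetric]) (intro measure_pmf.finite_measure_mono, auto)
  also have "\<dots> = (\<Sum>k\<in>S \<inter> {..m}. ?b k)"
    by (intro measure_measure_pmf_finite) auto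
  \<comment> \<open>The inserted weight is at least 1 on \<open>S\<close>. As it is nonnegative
    everywhere, the sum can then grow to all \<open>k \<le> m\<close>, where the binomial theorem
    evaluates it.\<close>
  also have "\<dots> \<le> (\<Sum>k\<in>S \<inter> {..m}. ?b k * (c * (r ^ k * s ^ (m - k))))"
    using S mult_left_mono[of 1 _ "?b _"] by (intro sum_mono) simp
  also have "\<dots> \<le> (\<Sum>k\<le>m. ?b k * (c * (r ^ k * s ^ (m - k))))"
    using nonneg by (intro sum_mono2) auto
  also have "\<dots> = c * (\<Sum>k\<le>m. of_nat (m choose k) * (p * r) ^ k * ((1 - p) * s) ^ (m - k))"
    using p by (simp add: sum_distrib_left power_mult_distrib mult_ac)
  also have "\<dots> = c * (p * r + (1 - p) * s) ^ m"
    by (simp only: binomial_ring)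
  finally show ?thesis .
qed

text \<open>Almost surely the two coordinates differ by less than \<open>t\<close>, so up to a null
  set the event that the second lies in \<open>A\<close> is contained in the event that the first
  lies in \<open>B\<close>; the marginals turn this into the claim.\<close>

lemma coupling_measure_le:
  assumes \<gamma>: "\<gamma> \<in> couplings \<mu> \<nu>"
    and less: "esssup \<gamma> (\<lambda>(x, y). ereal \<bar>x - y\<bar>) < ereal t"
    and borel: "A \<in> sets borel" "B \<in> sets borel"
    and sub: "\<And>x y. y \<in> A \<Longrightarrow> \<bar>x - y\<bar> < t \<Longrightarrow> x \<in> B"
  shows "measure \<nu> A \<le> measure \<mu> B"
proof -
  interpret prob_space \<gamma>
    using \<gamma> by (simp add: couplings_def)
  have sets: "sets \<gamma> = sets (borel \<Otimes>\<^sub>M borel)"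
    and \<mu>: "\<mu> = distr \<gamma> borel fst" and \<nu>: "\<nu> = distr \<gamma> borel snd"
    using \<gamma> by (auto simp: couplings_def)
  note [measurable_cong] = sets
  have "AE z in \<gamma>. (\<lambda>(x, y). ereal \<bar>x - y\<bar>) z \<le> esssup \<gamma> (\<lambda>(x, y). ereal \<bar>x - y\<bar>)"
    by (rule esssup_AE)
  then have "AE z in \<gamma>. \<bar>fst z - snd z\<bar> < t"
  proof eventually_elim
    case (elim z)
    then have "ereal \<bar>fst z - snd z\<bar> < ereal t"
      using less unfolding case_prod_beta by (rule order.strict_trans1)
    then show ?case by simp
  qed
  then have "measure \<gamma> (snd -` A \<inter> space \<gamma>) \<le> measure \<gamma> (fst -` B \<inter> space \<gamma>)"
    using borel by (intro finite_measure_mono_AE) (auto elim!: eventually_mono intro: sub)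
  then show ?thesis
    using borel by (simp add: \<mu> \<nu> measure_distr)
qed

text \<open>Rests on 64 \<le> (3/2)^12, which is about 129.7. It supplies the Chernoff weight
  condition with factor \<open>(3 / 2) ^ n\<close> and base 1/64.\<close>

lemma sixty_four_power_le:
  assumes "12 * k \<le> n"
  shows "1 \<le> (3 / 2 :: real) ^ n * (1 / 64) ^ k"
proof -
  have "(64 :: real) ^ k \<le> ((3 / 2) ^ 12) ^ k"
    by (intro power_mono) (simp_all add: power_divide)
  also have "\<dots> \<le> (3 / 2) ^ n"
    unfolding power_mult[symmetric] using assms by (intro power_increasing) auto
  finally show ?thesis
    by (simp add: power_divide field_simps)
qed

theorem proposition4p5:
  fixes p :: real
  assumes "p \<in> {0..1}"
  shows "\<exists>C::real. C > 0 \<and> (\<exists>N::nat. \<forall>n\<ge>N.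
           W_infinity (distr (measure_pmf (binomial_pmf (3 * n) (1 / 2))) borel (\<lambda>k. 2 * real k / 3))
                      (distr (measure_pmf (binomial_pmf (2 * n) p)) borel real)
             \<ge> ereal (C * real n))"
\<comment> \<open>1/18 is 2/3 of 1/12, the deviation allowed for \<open>X\<close> per unit of
  \<open>n\<close>. Starting at 1 makes the comparison of \<open>n\<close>-th powers in
  \<open>tail\<close> strict.\<close>
proof (intro exI[of _ "1 / 18"] conjI exI[of _ 1] allI impI)
  fix n :: nat
  assume n: "1 \<le> n"
  let ?X = "binomial_pmf (3 * n) (1 / 2)" and ?Y = "binomial_pmf (2 * n) p"
  let ?\<mu> = "distr ?X borel (\<lambda>k. 2 * real k / 3)" and ?\<nu> = "distr ?Y borel real"
  have p: "0 \<le> p" "p \<le> 1" using assms by auto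
  \<comment> \<open>Here 65/128 is the mean of 1 and 1/64, and (3/2) (65/128)^3 is about
    0.196.\<close>
  have tail: "(3 / 2) ^ n * (65 / 128) ^ (3 * n) < (1 / 4 :: real) ^ n"
  proof -
    have "(3 / 2) ^ n * (65 / 128) ^ (3 * n) = ((3 / 2) * (65 / 128) ^ 3 :: real) ^ n"
      by (simp only: power_mult_distrib power_mult)
    also have "\<dots> < (1 / 4) ^ n"
      using n by (intro power_strict_mono) (simp_all add: power_divide)
    finally show ?thesis .
  qed
  have endpoint: "(1 / 4) ^ n \<le> q ^ (2 * n)" if "1 / 2 \<le> q" for q :: real
  proof -
    have "(1 / 4) ^ n = (1 / 2 :: real) ^ (2 * n)"
      by (simp add: power_mult power2_eq_square)
    also have "\<dots> \<le> q ^ (2 * n)"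
      using that by (intro power_mono) auto
    finally show ?thesis .
  qed
  show "ereal (1 / 18 * real n) \<le> W_infinity ?\<mu> ?\<nu>"
    unfolding W_infinity_def
  proof (rule INF_greatest, rule ccontr)
    fix \<gamma>
    assume \<gamma>: "\<gamma> \<in> couplings ?\<mu> ?\<nu>"
      and "\<not> ereal (1 / 18 * real n) \<le> esssup \<gamma> (\<lambda>(x, y). ereal \<bar>x - y\<bar>)"
    then have less: "esssup \<gamma> (\<lambda>(x, y). ereal \<bar>x - y\<bar>) < ereal (real n / 18)"
      by simp
    show False
    proof (cases "p \<le> 1 / 2")
      case True
      have "(1 - p) ^ (2 * n) = measure ?Y {0}"
        using p by (simp add: measure_pmf_single)
      also have "\<dots> = measure ?\<nu> {0}"
        by (subst measure_distr) (auto intro!: arg_cong[where f = "measure _"])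
      also have "\<dots> \<le> measure ?\<mu> {..<real n / 18}"
        by (rule coupling_measure_le[OF \<gamma> less]) auto
      also have "\<dots> = measure ?X {k. 12 * k < n}"
        by (subst measure_distr) (auto intro!: arg_cong[where f = "measure _"])
      also have "\<dots> \<le> (3 / 2) ^ n * (1 / 2 * (1 / 64) + (1 - 1 / 2) * 1) ^ (3 * n)"
        by (rule measure_binomial_pmf_le) (use sixty_four_power_le in auto)
      finally show False
        using tail endpoint[of "1 - p"] True by simp
    next
      case False
      have "p ^ (2 * n) = measure ?Y {2 * n}"
        using p by (simp add: measure_pmf_single)
      also have "\<dots> = measure ?\<nu> {real (2 * n)}"
        by (subst measure_distr) (auto intro!: arg_cong[where f = "measure _"])
      also have "\<dots> \<le> measure ?\<mu> {2 * real n - real n / 18<..}"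
      proof (rule coupling_measure_le[OF \<gamma> less])
        fix x y :: real
        assume "y \<in> {real (2 * n)}" "\<bar>x - y\<bar> < real n / 18"
        then show "x \<in> {2 * real n - real n / 18<..}"
          unfolding abs_less_iff by auto
      qed auto
      \<comment> \<open>This says \<open>12 * (3 * n - k) < n\<close> without natural subtraction:
        fewer than n/12 failures, so the weight 1/64 now goes to failures.\<close>
      also have "\<dots> = measure ?X {k. 36 * n < n + 12 * k}"
        by (subst measure_distr) (auto intro!: arg_cong[where f = "measure _"])
      also have "\<dots> \<le> (3 / 2) ^ n * (1 / 2 * 1 + (1 - 1 / 2) * (1 / 64)) ^ (3 * n)"
      proof (rule measure_binomial_pmf_le)
        fix k
        assume "k \<in> {k. 36 * n < n + 12 * k}" "k \<le> 3 * n"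
        then show "1 \<le> (3 / 2 :: real) ^ n * (1 ^ k * (1 / 64) ^ (3 * n - k))"
          using sixty_four_power_le[of "3 * n - k" n] by auto
      qed auto
      finally show False
        using tail endpoint[of p] False by simp
    qed
  qed
qed simp

end
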